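(* Let $(\mathfrak g,\omega)$ be a two-step nilpotent symplectic Lie algebra. Then: 1. The ideal $C^1\mathfrak g=[\mathfrak g,\mathfrak g]$ is isotropic. 2. $(\mathfrak g,\omega)$ has a Lagrangian ideal.
   Context: All Lie algebras are finite-dimensional over a fixed field $k$ of characteristic $0$. A symplectic Lie algebra $(\mathfrak g,\omega)$ is a Lie algebra with a non-degenerate alternating form $\omega$ satisfying $\omega([u,v],w)+\omega([w,u],v)+\omega([v,w],u)=0$. Two-step nilpotent means $[\mathfrak g,[\mathfrak g,\mathfrak g]]=0$. A subspace is isotropic if $\omega$ vanishes on it; a Lagrangian ideal is an ideal of $\mathfrak g$ equal to its $\omega$-orthogonal. *)

theory Defs
  imports Complex_Main
begin

text \<open>
  The underlying vector space of a Lie algebra is a whole type \<open>'v\<close>; the ground field \<open>'k\<close> enters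
  only through the scalar multiplication.  The dimension may be zero.
\<close>

locale lie_algebra = vector_space scale
  for scale :: "'k::field_char_0 \<Rightarrow> 'v::ab_group_add \<Rightarrow> 'v" (infixr \<open>\<cdot>\<close> 75) +
  fixes bracket :: "'v \<Rightarrow> 'v \<Rightarrow> 'v"
  assumes finite_dimensional: "\<exists>B. finite B \<and> span B = UNIV"
    and bracket_linear_left: "Vector_Spaces.linear scale scale (\<lambda>x. bracket x y)"
    and bracket_linear_right: "Vector_Spaces.linear scale scale (\<lambda>y. bracket x y)"
    and bracket_self: "bracket x x = 0"
    and jacobi: "bracket x (bracket y z) + bracket y (bracket z x) + bracket z (bracket x y) = 0"
begin

definition bracket_space :: "'v set \<Rightarrow> 'v set \<Rightarrow> 'v set" where
  "bracket_space A B = span {bracket a b |a b. a \<in> A \<and> b \<in> B}"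

definition derived_ideal :: "'v set" where
  "derived_ideal = bracket_space UNIV UNIV"

text \<open>Nilpotency class at most two: abelian Lie algebras are included.\<close>

definition two_step_nilpotent :: bool where
  "two_step_nilpotent \<longleftrightarrow> bracket_space UNIV derived_ideal = {0}"

definition lie_ideal :: "'v set \<Rightarrow> bool" where
  "lie_ideal I \<longleftrightarrow> subspace I \<and> (\<forall>x. \<forall>y\<in>I. bracket x y \<in> I)"

end

locale symplectic_lie_algebra = lie_algebra scale bracket
  for scale :: "'k::field_char_0 \<Rightarrow> 'v::ab_group_add \<Rightarrow> 'v" (infixr \<open>\<cdot>\<close> 75)
    and bracket :: "'v \<Rightarrow> 'v \<Rightarrow> 'v" +
  fixes \<omega> :: "'v \<Rightarrow> 'v \<Rightarrow> 'k"
  assumes form_linear_left: "Vector_Spaces.linear scale (*) (\<lambda>x. \<omega> x y)"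
    and form_linear_right: "Vector_Spaces.linear scale (*) (\<lambda>y. \<omega> x y)"
    and form_alternating: "\<omega> x x = 0"
    and form_nondegenerate: "(\<And>y. \<omega> x y = 0) \<Longrightarrow> x = 0"
    and form_closed: "\<omega> (bracket u v) w + \<omega> (bracket w u) v + \<omega> (bracket v w) u = 0"
begin

definition orthogonal_space :: "'v set \<Rightarrow> 'v set" where
  "orthogonal_space U = {x. \<forall>u\<in>U. \<omega> x u = 0}"

definition isotropic :: "'v set \<Rightarrow> bool" where
  "isotropic U \<longleftrightarrow> subspace U \<and> (\<forall>x\<in>U. \<forall>y\<in>U. \<omega> x y = 0)"

definition lagrangian_ideal :: "'v set \<Rightarrow> bool" where
  "lagrangian_ideal L \<longleftrightarrow> lie_ideal L \<and> orthogonal_space L = L"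

end

end

theory Submission
  imports Defs
begin

text \<open>
  In the closedness identity for \<open>\<omega>\<close> with \<open>w\<close> central, two of the three terms vanish; so the centre
  is orthogonal to the derived ideal, which in the two-step nilpotent case lies in the centre and is
  therefore isotropic. By Zorn's lemma the derived ideal is contained in a maximal isotropic
  subspace, which is Lagrangian by maximality and an ideal because it contains all brackets.
\<close>

context lie_algebra
begin

lemma bracket_anticommute: "bracket x y = - bracket y x"
proof -
  \<comment> \<open>Polarization: the left side is \<open>bracket (x + y) (x + y)\<close> expanded
    in its first argument only.\<close>
  have "bracket x (x + y) + bracket y (x + y) = 0"
    using module_hom.add[OF Vector_Spaces.linear.axioms(3)[OF bracket_linear_left], of x y "x + y"]
    by (simp add: bracket_self)
  then have "bracket x y + bracket y x = 0"
    by (simp add: module_hom.add[OF Vector_Spaces.linear.axioms(3)[OF bracket_linear_right]] bracket_self)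
  then show ?thesis
    by (simp add: eq_neg_iff_add_eq_0)
qed

lemma subspace_derived_ideal: "subspace derived_ideal"
  by (simp add: derived_ideal_def bracket_space_def)

lemma bracket_in_derived_ideal: "bracket x y \<in> derived_ideal"
  unfolding derived_ideal_def bracket_space_def by (rule span_base) blast

lemma derived_ideal_least:
  assumes "subspace U" and "\<And>x y. bracket x y \<in> U"
  shows "derived_ideal \<subseteq> U"
  unfolding derived_ideal_def bracket_space_def
  using assms by (intro span_minimal) auto

text \<open>Every bracket lies in \<open>derived_ideal\<close>, hence in \<open>U\<close>, whatever
  its arguments are. So in the search for a Lagrangian ideal only the inclusion of
  \<open>derived_ideal\<close> has to be secured.\<close>

lemma lie_ideal_if_derived_ideal_subset:
  assumes "subspace U" and "derived_ideal \<subseteq> U"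
  shows "lie_ideal U"
  using assms bracket_in_derived_ideal by (auto simp: lie_ideal_def)

lemma two_step_nilpotent_central:
  assumes two_step_nilpotent and "z \<in> derived_ideal"
  shows "bracket x z = 0"
proof -
  have "bracket x z \<in> bracket_space UNIV derived_ideal"
    unfolding bracket_space_def using assms(2) by (intro span_base) blast
  then show ?thesis
    using assms(1) by (simp add: two_step_nilpotent_def)
qed

end

context symplectic_lie_algebra
begin

lemma form_zero_left [simp]: "\<omega> 0 y = 0"
  using module_hom.zero[OF Vector_Spaces.linear.axioms(3)[OF form_linear_left]] .

lemma form_add_left: "\<omega> (x + y) z = \<omega> x z + \<omega> y z"
  using module_hom.add[OF Vector_Spaces.linear.axioms(3)[OF form_linear_left]] .

lemma form_add_right: "\<omega> x (y + z) = \<omega> x y + \<omega> x z"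
  using module_hom.add[OF Vector_Spaces.linear.axioms(3)[OF form_linear_right]] .

lemma form_scale_left: "\<omega> (c \<cdot> x) y = c * \<omega> x y"
  using module_hom.scale[OF Vector_Spaces.linear.axioms(3)[OF form_linear_left]] .

lemma form_scale_right: "\<omega> x (c \<cdot> y) = c * \<omega> x y"
  using module_hom.scale[OF Vector_Spaces.linear.axioms(3)[OF form_linear_right]] .

lemma form_skew: "\<omega> x y = - \<omega> y x"
proof -
  have "\<omega> x y + \<omega> y x = \<omega> (x + y) (x + y)"
    unfolding form_add_left form_add_right by (simp add: form_alternating)
  then have "\<omega> x y + \<omega> y x = 0"
    by (simp only: form_alternating)
  then show ?thesis
    by (simp add: eq_neg_iff_add_eq_0)
qed

lemma subspace_orthogonal_space: "subspace (orthogonal_space U)"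
  by (rule subspaceI) (auto simp: orthogonal_space_def form_add_left form_scale_left)

lemma isotropic_iff_subset_orthogonal:
  "isotropic U \<longleftrightarrow> subspace U \<and> U \<subseteq> orthogonal_space U"
  by (auto simp: isotropic_def orthogonal_space_def)

lemma central_orthogonal_derived_ideal:
  assumes "\<And>x. bracket x z = 0" and "d \<in> derived_ideal"
  shows "\<omega> d z = 0"
proof -
  \<comment> \<open>In \<open>form_closed\<close> the element \<open>z\<close> occurs once in each
    slot of a bracket, as \<open>bracket z u\<close> and \<open>bracket v z\<close>, so its
    centrality is needed on both sides.\<close>
  have left: "bracket z x = 0" for x
    using assms(1)[of x] bracket_anticommute[of z x] by simp
  have "\<omega> (bracket u v) z = 0" for u v
    using form_closed[of u v z] by (simp add: assms(1) left)
  \<comment> \<open>Being orthogonal to \<open>z\<close> is a linear condition, so it passes from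
    brackets to their span.\<close>
  then have "derived_ideal \<subseteq> orthogonal_space {z}"
    by (intro derived_ideal_least subspace_orthogonal_space) (simp add: orthogonal_space_def)
  then show ?thesis
    using assms(2) by (auto simp: orthogonal_space_def)
qed

lemma isotropic_derived_ideal:
  assumes two_step_nilpotent
  shows "isotropic derived_ideal"
  unfolding isotropic_def
  using subspace_derived_ideal central_orthogonal_derived_ideal two_step_nilpotent_central[OF assms]
  by blast

text \<open>Elements of the span have the form \<open>u + c \<cdot> x\<close> with \<open>u\<close>
  in \<open>U\<close>. When the form is expanded on two of them, the mixed terms vanish by
  orthogonality and the term in \<open>x\<close> alone because the form is alternating.\<close>

lemma isotropic_span_insert:
  assumes "isotropic U" and "x \<in> orthogonal_space U"
  shows "isotropic (span (insert x U))"
  unfolding isotropic_def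
proof (intro conjI ballI)
  fix a b
  assume "a \<in> span (insert x U)" and "b \<in> span (insert x U)"
  moreover have "span U = U"
    using assms(1) by (simp add: isotropic_def)
  ultimately obtain c d where U: "a - c \<cdot> x \<in> U" "b - d \<cdot> x \<in> U"
    by (auto simp: span_breakdown_eq)
  define a' where "a' = a - c \<cdot> x"
  define b' where "b' = b - d \<cdot> x"
  have ab: "a = a' + c \<cdot> x" "b = b' + d \<cdot> x"
    by (simp_all add: a'_def b'_def)
  have "\<omega> a' b' = 0" "\<omega> x b' = 0" "\<omega> x a' = 0"
    using assms U by (auto simp: isotropic_def orthogonal_space_def a'_def b'_def)
  moreover have "\<omega> a' x = 0"
    using form_skew[of a' x] \<open>\<omega> x a' = 0\<close> by simp
  ultimately show "\<omega> a b = 0"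
    by (simp add: ab form_add_left form_add_right form_scale_left form_scale_right form_alternating)
qed simp

text \<open>The conditions for isotropy involve at most two vectors at a time, and two vectors from
  the union of a chain already lie in one member. Nonemptiness of the chain supplies the zero
  vector.\<close>

lemma isotropic_Union_chain:
  assumes "C \<noteq> {}" and "subset.chain {U. isotropic U} C"
  shows "isotropic (\<Union>C)"
proof -
  have iso: "isotropic U" if "U \<in> C" for U
    using assms(2) that by (auto simp: subset_chain_def)
  have common: "\<exists>U\<in>C. a \<in> U \<and> b \<in> U" if "a \<in> \<Union>C" "b \<in> \<Union>C" for a b
  proof -
    from that obtain U V where "U \<in> C" "V \<in> C" "a \<in> U" "b \<in> V"
      by blast
    moreover from this have "U \<subseteq> V \<or> V \<subseteq> U"
      using assms(2) by (auto simp: subset_chain_def)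
    ultimately show ?thesis
      by blast
  qed
  have "subspace (\<Union>C)"
  proof (rule subspaceI)
    show "0 \<in> \<Union>C"
      using assms(1) iso subspace_0 by (auto simp: isotropic_def)
    show "a + b \<in> \<Union>C" if "a \<in> \<Union>C" "b \<in> \<Union>C" for a b
    proof -
      from common[OF that] obtain U where "U \<in> C" "a \<in> U" "b \<in> U"
        by blast
      with iso have "a + b \<in> U"
        by (simp add: isotropic_def subspace_add)
      with \<open>U \<in> C\<close> show ?thesis
        by blast
    qed
    show "c \<cdot> a \<in> \<Union>C" if "a \<in> \<Union>C" for c a
      using that iso by (auto simp: isotropic_def intro: subspace_scale)
  qed
  moreover have "\<omega> a b = 0" if "a \<in> \<Union>C" "b \<in> \<Union>C" for a b
    using common[OF that] iso by (auto simp: isotropic_def)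
  ultimately show ?thesis
    by (simp add: isotropic_def)
qed

lemma isotropic_subset_self_orthogonal:
  assumes "isotropic D"
  obtains L where "subspace L" "D \<subseteq> L" "orthogonal_space L = L"
proof -
  let ?A = "{U. isotropic U \<and> D \<subseteq> U}"
  have "\<exists>M\<in>?A. \<forall>X\<in>?A. M \<subseteq> X \<longrightarrow> X = M"
  proof (rule subset_Zorn_nonempty)
    show "?A \<noteq> {}"
      using assms by auto
    show "\<Union>C \<in> ?A" if "C \<noteq> {}" "subset.chain ?A C" for C
    proof -
      have "C \<subseteq> ?A" and "subset.chain {U. isotropic U} C"
        using that(2) by (auto simp: subset_chain_def)
      then show ?thesis
        using that(1) isotropic_Union_chain[of C] by blast
    qed
  qed
  then obtain L where "L \<in> ?A" and "\<forall>X\<in>?A. L \<subseteq> X \<longrightarrow> X = L" ..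
  \<comment> \<open>The condition \<open>D \<subseteq> X\<close> disappears from the maximality
    statement, since it follows from \<open>L \<subseteq> X\<close>.\<close>
  then have L: "isotropic L" "D \<subseteq> L"
    and max: "isotropic X \<Longrightarrow> L \<subseteq> X \<Longrightarrow> X = L" for X
    by (simp_all add: subset_trans[of D L X])
  \<comment> \<open>Adjoining such an \<open>x\<close> to \<open>L\<close> keeps it isotropic, so by
    maximality nothing new is added. The reverse inclusion is the isotropy of
    \<open>L\<close>.\<close>
  have "x \<in> L" if "x \<in> orthogonal_space L" for x
  proof -
    have "insert x L \<subseteq> span (insert x L)"
      by (rule span_superset)
    moreover from this have "span (insert x L) = L"
      by (intro max isotropic_span_insert L(1) that) blast
    ultimately show ?thesis
      by blast
  qed
  then have "orthogonal_space L = L"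
    using L(1) by (auto simp: isotropic_iff_subset_orthogonal)
  then show thesis
    using that[of L] L by (simp add: isotropic_def)
qed

lemma lagrangian_ideal_exists:
  assumes two_step_nilpotent
  shows "\<exists>L. lagrangian_ideal L"
proof -
  obtain L where "subspace L" "derived_ideal \<subseteq> L" "orthogonal_space L = L"
    by (rule isotropic_subset_self_orthogonal[OF isotropic_derived_ideal[OF assms]])
  then show ?thesis
    using lie_ideal_if_derived_ideal_subset by (auto simp: lagrangian_ideal_def)
qed

end

theorem theorem8p3:
  fixes scale :: "'k::field_char_0 \<Rightarrow> 'v::ab_group_add \<Rightarrow> 'v"
    and bracket :: "'v \<Rightarrow> 'v \<Rightarrow> 'v"
    and \<omega> :: "'v \<Rightarrow> 'v \<Rightarrow> 'k"
  assumes "symplectic_lie_algebra scale bracket \<omega>"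
    and "lie_algebra.two_step_nilpotent scale bracket"
  shows "lie_algebra.lie_ideal scale bracket (lie_algebra.derived_ideal scale bracket)
      \<and> symplectic_lie_algebra.isotropic scale \<omega> (lie_algebra.derived_ideal scale bracket)
      \<and> (\<exists>L. symplectic_lie_algebra.lagrangian_ideal scale bracket \<omega> L)"
proof -
  interpret symplectic_lie_algebra scale bracket \<omega>
    by (rule assms(1))
  show ?thesis
    \<comment> \<open>Here \<open>U\<close> is the derived ideal itself, so the required inclusion
      is reflexivity.\<close>
    using lie_ideal_if_derived_ideal_subset[OF subspace_derived_ideal order_refl]
      isotropic_derived_ideal[OF assms(2)] lagrangian_ideal_exists[OF assms(2)]
    by blast
qed

end
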